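(* The product $\bullet$ on $\mathbb{K}\langle x_0,x_1\rangle$ satisfies: 1. For every word $c$, $\emptyset\bullet c=0$. 2. For all words $c,d$, $(x_0c)\bullet d=x_0(c\bullet d)$. 3. For all words $c,d$, $(x_1c)\bullet d=x_1(c\bullet d)+x_0(c\sqcup\!\sqcup d)$.
   Context: $\mathbb{K}$ is a field of characteristic zero. $\mathbb{K}\langle\langle x_0,x_1\rangle\rangle$ is the space of noncommutative formal series in $x_0,x_1$, with its usual ultrametric topology; it is an algebra for concatenation and for the shuffle product $\sqcup\!\sqcup$ (determined by $\emptyset\sqcup\!\sqcup w=w\sqcup\!\sqcup\emptyset=w$ and $au\sqcup\!\sqcup bv=a(u\sqcup\!\sqcup bv)+b(au\sqcup\!\sqcup v)$ for letters $a,b$ and words $u,v,w$, extended bilinearly and continuously). $\emptyset$ is the empty word. $\mathbb{K}\langle x_0,x_1\rangle$ is the subspace of noncommutative polynomials. For $d\in\mathbb{K}\langle\langle x_0,x_1\rangle\rangle$, $\varphi_d$ is the continuous algebra map (for concatenation) from $\mathbb{K}\langle\langle x_0,x_1\rangle\rangle$ to $\mathrm{End}(\mathbb{K}\langle\langle x_0,x_1\rangle\rangle)$ such that $\varphi_d(x_0)(X)=x_0X$ and $\varphi_d(x_1)(X)=x_1X+x_0(d\sqcup\!\sqcup X)$ for all $X$. The composition $c\circ d=\varphi_d(c)(\emptyset)+d$ is associative. For a word $c$, $X_c$ is the linear form giving the coefficient of $c$; $V$ is the span of all the $X_c$, and $H=S(V)$. Elements of $H$ (resp. $H\otimes H$)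 are seen as polynomial functions on $\mathbb{K}\langle\langle x_0,x_1\rangle\rangle$ (resp. on its square). $\Delta:H\to H\otimes H$ is the algebra morphism such that $\Delta(X_c)(f,g)=X_c(f\circ g)$ for every word $c$ and all series $f,g$. Let $\pi:H=S(V)\to V$ be the canonical projection, and $\delta=(\pi\otimes\pi)\circ\Delta_{|V}:V\to V\otimes V$ (a right prelie coproduct). $V$ is graded with finite-dimensional components ($X_c$ having degree the length of $c$ plus one plus the number of letters $x_0$ in $c$), $\delta$ is homogeneous, and the graded dual of $V$ is identified with $\mathbb{K}\langle x_0,x_1\rangle$ through $X_c(d)=\delta_{c,d}$ (Kronecker) for words $c,d$. The product $\bullet$ on $\mathbb{K}\langle x_0,x_1\rangle$ is dual to $\delta$: for all words $u,v,w$, $X_w(u\bullet v)=\delta(X_w)(u\otimes v)$. *)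

theory Defs
  imports "HOL-Library.Poly_Mapping" "HOL-Library.Product_Plus"
begin

section \<open>Words, noncommutative polynomials and series\<close>

datatype letter = X0 | X1

type_synonym word = "letter list"

instance letter :: finite
proof
  have "(UNIV :: letter set) \<subseteq> {X0, X1}"
    by (auto intro: letter.exhaust)
  then show "finite (UNIV :: letter set)"
    by (rule finite_subset) simp
qed

text \<open>
  Lists form the free monoid, written additively with concatenation as addition and the empty word
  as zero. With this instance the library's convolution product on finitely supported functions
  makes \<open>'k ncpoly\<close> the algebra of noncommutative polynomials with the concatenation product.
\<close>

instantiation list :: (type) monoid_add
begin

definition zero_list :: "'a list" where "zero_list = []"

definition plus_list :: "'a list \<Rightarrow> 'a list \<Rightarrow> 'a list" where "plus_list = (@)"

instance
  by standard (simp_all add: zero_list_def plus_list_def)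

end

abbreviation lookup :: "('a \<Rightarrow>\<^sub>0 'b::zero) \<Rightarrow> 'a \<Rightarrow> 'b" where
  "lookup \<equiv> Poly_Mapping.lookup"

abbreviation keys :: "('a \<Rightarrow>\<^sub>0 'b::zero) \<Rightarrow> 'a set" where
  "keys \<equiv> Poly_Mapping.keys"

abbreviation single :: "'a \<Rightarrow> 'b \<Rightarrow> 'a \<Rightarrow>\<^sub>0 'b::zero" where
  "single \<equiv> Poly_Mapping.single"

type_synonym 'k ncpoly = "word \<Rightarrow>\<^sub>0 'k"

type_synonym 'k series = "word \<Rightarrow> 'k"

definition of_word :: "word \<Rightarrow> 'k::field_char_0 ncpoly" where
  "of_word c = single c 1"

abbreviation of_letter :: "letter \<Rightarrow> 'k::field_char_0 ncpoly" where
  "of_letter a \<equiv> of_word [a]"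

definition conc :: "'k::field_char_0 series \<Rightarrow> 'k series \<Rightarrow> 'k series" where
  "conc f g = (\<lambda>w. \<Sum>i\<le>length w. f (take i w) * g (drop i w))"

fun shuffle_word :: "word \<Rightarrow> word \<Rightarrow> 'k::field_char_0 ncpoly" where
  "shuffle_word [] w = of_word w"
| "shuffle_word w [] = of_word w"
| "shuffle_word (a # u) (b # v) =
     of_letter a * shuffle_word u (b # v) + of_letter b * shuffle_word (a # u) v"

text \<open>
  The bilinear continuous extension: \<open>shuffle_word u v\<close> is homogeneous of length
  \<open>length u + length v\<close>, so each coefficient is a finite sum.
\<close>

definition shuffle :: "'k::field_char_0 series \<Rightarrow> 'k series \<Rightarrow> 'k series" where
  "shuffle f g = (\<lambda>w. \<Sum>(u, v) | length u + length v = length w.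
     f u * g v * lookup (shuffle_word u v) w)"


section \<open>The composition of series\<close>

fun phi_letter :: "'k::field_char_0 series \<Rightarrow> letter \<Rightarrow> 'k series \<Rightarrow> 'k series" where
  "phi_letter d X0 X = conc (lookup (of_letter X0)) X"
| "phi_letter d X1 X =
     (\<lambda>w. conc (lookup (of_letter X1)) X w + conc (lookup (of_letter X0)) (shuffle d X) w)"

primrec phi_word :: "'k::field_char_0 series \<Rightarrow> word \<Rightarrow> 'k series \<Rightarrow> 'k series" where
  "phi_word d [] X = X"
| "phi_word d (a # c) X = phi_letter d a (phi_word d c X)"

text \<open>
  The continuous extension to series. Each \<open>phi_letter d a\<close> raises the valuation by at least one,
  so words \<open>c\<close> longer than \<open>w\<close> do not contribute to the coefficient of \<open>w\<close>. The lemmas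
  \<open>phi_one\<close>, \<open>phi_X0\<close>, \<open>phi_X1\<close>, \<open>phi_conc\<close> and \<open>phi_continuous\<close> below state that this is the
  continuous algebra morphism with the prescribed values on the letters.
\<close>

definition phi :: "'k::field_char_0 series \<Rightarrow> 'k series \<Rightarrow> 'k series \<Rightarrow> 'k series" where
  "phi d f X = (\<lambda>w. \<Sum>c | length c \<le> length w. f c * phi_word d c X w)"

definition series_comp :: "'k::field_char_0 series \<Rightarrow> 'k series \<Rightarrow> 'k series" where
  "series_comp f d = (\<lambda>w. phi d f (lookup (of_word [])) w + d w)"

lemma finite_words [simp]: "finite {c::word. length c \<le> n}"
  using finite_lists_length_le[of "UNIV::letter set" n] by simp

lemma finite_word_pairs [simp]: "finite {(u::word, v::word). length u + length v = n}"
  by (rule finite_subset[of _ "{c. length c \<le> n} \<times> {c. length c \<le> n}"]) auto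

lemma conc_letter [simp]:
  "conc (lookup (of_letter a)) X [] = 0"
  "conc (lookup (of_letter a)) X (b # w) = (if a = b then X w else 0)"
proof -
  show "conc (lookup (of_letter a)) X [] = 0"
    by (simp add: conc_def of_word_def lookup_single)
  have "conc (lookup (of_letter a)) X (b # w) =
      (\<Sum>i\<in>{1}. lookup (of_letter a) (take i (b # w)) * X (drop i (b # w)))"
    unfolding conc_def
  proof (rule sum.mono_neutral_right)
    show "\<forall>i\<in>{..length (b # w)} - {1}.
        lookup (of_letter a) (take i (b # w)) * X (drop i (b # w)) = 0"
    proof
      fix i assume i: "i \<in> {..length (b # w)} - {1}"
      then have "length (take i (b # w)) \<noteq> length [a]" by auto
      then have "take i (b # w) \<noteq> [a]" by metis
      then show "lookup (of_letter a) (take i (b # w)) * X (drop i (b # w)) = 0"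
        by (simp add: of_word_def lookup_single when_def)
    qed
  qed auto
  then show "conc (lookup (of_letter a)) X (b # w) = (if a = b then X w else 0)"
    by (auto simp: of_word_def lookup_single when_def)
qed

lemma lookup_times: "lookup (p * q) = conc (lookup p) (lookup q)"
proof
  fix w :: word
  let ?h = "\<lambda>i. (take i w, drop i w)"
  let ?F = "\<lambda>(a, b). lookup p a * lookup q b when w = a + b"
  have "lookup (p * q) w = Sum_any ?F"
    by (simp add: times_poly_mapping.rep_eq prod_fun_unfold_prod)
  also have "\<dots> = sum ?F (?h ` {..length w})"
  proof (rule Sum_any.expand_superset)
    show "{x. ?F x \<noteq> 0} \<subseteq> ?h ` {..length w}"
    proof
      fix x assume "x \<in> {x. ?F x \<noteq> 0}"
      then have "fst x @ snd x = w"
        by (cases x) (auto simp: plus_list_def when_def split: if_splits)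
      then show "x \<in> ?h ` {..length w}"
        by (intro image_eqI[of _ _ "length (fst x)"]) auto
    qed
  qed simp
  also have "\<dots> = (\<Sum>i\<le>length w. lookup p (take i w) * lookup q (drop i w))"
  proof (subst sum.reindex)
    show "inj_on ?h {..length w}"
      by (rule inj_on_inverseI[of _ "\<lambda>x. length (fst x)"]) auto
  qed (simp add: plus_list_def)
  finally show "lookup (p * q) w = conc (lookup p) (lookup q) w"
    by (simp add: conc_def)
qed

lemma lookup_shuffle_word_eq_0:
  "length w \<noteq> length u + length v \<Longrightarrow> lookup (shuffle_word u v) w = 0"
proof (induction u v arbitrary: w rule: shuffle_word.induct)
  case (3 a u b v)
  then show ?case
    by (cases w) (auto simp: lookup_add lookup_times)
qed (auto simp: of_word_def lookup_single when_def)

lemma shuffle_of_word: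
  "shuffle (lookup (of_word u)) (lookup (of_word v)) =
     lookup (shuffle_word u v)"
proof
  fix w :: word
  let ?S = "{(a::word, b::word). length a + length b = length w}"
  let ?F = "\<lambda>(a, b). lookup (of_word u) a * lookup (of_word v) b * lookup (shuffle_word a b) w"
  have "shuffle (lookup (of_word u)) (lookup (of_word v)) w = sum ?F ?S"
    by (simp add: shuffle_def)
  also have "\<dots> = sum ?F (insert (u, v) ?S)"
    by (rule sum.mono_neutral_left) (auto, metis lookup_shuffle_word_eq_0)
  also have "\<dots> = sum ?F {(u, v)}"
    by (rule sum.mono_neutral_right) (auto simp: of_word_def lookup_single when_def split: if_splits)
  also have "\<dots> = lookup (shuffle_word u v) w"
    by (simp add: of_word_def)
  finally show "shuffle (lookup (of_word u)) (lookup (of_word v)) w =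
      lookup (shuffle_word u v) w" .
qed

lemma phi_letter_cong:
  assumes "\<And>v. length v < length w \<Longrightarrow> X v = Y v"
  shows "phi_letter d a X w = phi_letter d a Y w"
proof (cases w)
  case Nil
  then show ?thesis by (cases a) auto
next
  case (Cons b v)
  then show ?thesis using assms
    by (cases a) (auto simp: shuffle_def intro!: sum.cong)
qed

lemma phi_letter_sum:
  "phi_letter d a (\<lambda>w. \<Sum>i\<in>I. k i * X i w) w = (\<Sum>i\<in>I. k i * phi_letter d a (X i) w)"
proof (cases w)
  case Nil
  then show ?thesis by (cases a) auto
next
  case (Cons b v)
  have "shuffle d (\<lambda>w. \<Sum>i\<in>I. k i * X i w) v = (\<Sum>i\<in>I. k i * shuffle d (X i) v)"
    unfolding shuffle_def sum_distrib_left
    by (subst sum.swap) (auto simp: sum_distrib_left sum_distrib_right mult_ac intro!: sum.cong)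
  with Cons show ?thesis
    by (cases a) (auto simp: sum.distrib distrib_left)
qed

lemma phi_word_cong:
  assumes "\<And>v. length v \<le> length w \<Longrightarrow> X v = Y v"
  shows "phi_word d c X w = phi_word d c Y w"
  using assms by (induction c arbitrary: w) (auto intro!: phi_letter_cong)

lemma phi_word_sum:
  "phi_word d c (\<lambda>w. \<Sum>i\<in>I. k i * X i w) w = (\<Sum>i\<in>I. k i * phi_word d c (X i) w)"
proof (induction c arbitrary: w)
  case (Cons a c)
  have "phi_word d c (\<lambda>w. \<Sum>i\<in>I. k i * X i w) = (\<lambda>w. \<Sum>i\<in>I. k i * phi_word d c (X i) w)"
    using Cons.IH by blast
  then show ?case by (simp add: phi_letter_sum)
qed simp

lemma phi_word_append: "phi_word d (b @ c) X = phi_word d b (phi_word d c X)"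
  by (induction b) auto

lemma phi_word_eq_0: "length w < length c \<Longrightarrow> phi_word d c X w = 0"
proof (induction c arbitrary: w)
  case (Cons a c)
  have "phi_letter d a (phi_word d c X) w = phi_letter d a (\<lambda>_. 0) w"
    using Cons by (intro phi_letter_cong) auto
  also have "\<dots> = 0"
    using phi_letter_sum[of d a "\<lambda>_. 0" "\<lambda>_ _. 0" "{}" w] by simp
  finally show ?case by simp
qed simp

lemma phi_eq_sum:
  assumes "length w \<le> n"
  shows "phi d f X w = (\<Sum>c | length c \<le> n. f c * phi_word d c X w)"
  unfolding phi_def using assms
  by (intro sum.mono_neutral_left) (auto simp: phi_word_eq_0)

lemma phi_single: "phi d (lookup (of_word c)) X = phi_word d c X"
proof
  fix w
  have "phi d (lookup (of_word c)) X w
      = (\<Sum>b | length b \<le> length w + length c. lookup (of_word c) b * phi_word d b X w)"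
    by (rule phi_eq_sum) simp
  also have "\<dots> = (\<Sum>b\<in>{c}. lookup (of_word c) b * phi_word d b X w)"
    by (rule sum.mono_neutral_right) (auto simp: of_word_def lookup_single when_def)
  finally show "phi d (lookup (of_word c)) X w = phi_word d c X w"
    by (simp add: of_word_def)
qed

lemma phi_one: "phi d (lookup (of_word [])) X = X"
  by (simp add: phi_single)

lemma phi_X0: "phi d (lookup (of_letter X0)) X = conc (lookup (of_letter X0)) X"
  by (simp add: phi_single)

lemma phi_X1:
  "phi d (lookup (of_letter X1)) X =
     (\<lambda>w. conc (lookup (of_letter X1)) X w + conc (lookup (of_letter X0)) (shuffle d X) w)"
  by (simp add: phi_single)

lemma phi_linear: "phi d (\<lambda>w. k * f w + g w) X = (\<lambda>w. k * phi d f X w + phi d g X w)"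
  by (auto simp: phi_def sum.distrib sum_distrib_left algebra_simps)

lemma phi_endo: "phi d f (\<lambda>w. k * X w + Y w) = (\<lambda>w. k * phi d f X w + phi d f Y w)"
proof -
  have "phi_word d c (\<lambda>w. k * X w + Y w) w = k * phi_word d c X w + phi_word d c Y w" for c w
    using phi_word_sum[of d c "\<lambda>b. if b then k else 1" "\<lambda>b. if b then X else Y" UNIV w]
    by (simp add: UNIV_bool add.commute)
  then show ?thesis
    by (auto simp: phi_def sum.distrib sum_distrib_left algebra_simps)
qed

lemma phi_continuous:
  assumes "\<And>c. length c \<le> n \<Longrightarrow> f c = g c" and "length w \<le> n"
  shows "phi d f X w = phi d g X w"
  using assms by (auto simp: phi_def intro!: sum.cong)

lemma phi_conc: "phi d (conc f g) X = phi d f (phi d g X)"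
proof
  fix w :: word
  define n where "n = length w"
  define W where "W = {c::word. length c \<le> n}"
  have fin: "finite W" by (simp add: W_def)
  have "phi d f (phi d g X) w = (\<Sum>b\<in>W. f b * phi_word d b (phi d g X) w)"
    by (simp add: phi_def W_def n_def)
  also have "\<dots> = (\<Sum>b\<in>W. f b * phi_word d b (\<lambda>v. \<Sum>c\<in>W. g c * phi_word d c X v) w)"
    by (intro sum.cong refl arg_cong2[where f = "(*)"] phi_word_cong)
       (auto simp: W_def n_def phi_eq_sum)
  also have "\<dots> = (\<Sum>b\<in>W. \<Sum>c\<in>W. f b * g c * phi_word d (b @ c) X w)"
    by (simp add: phi_word_sum phi_word_append sum_distrib_left mult.assoc)
  also have "\<dots> = (\<Sum>(b, c)\<in>W \<times> W. f b * g c * phi_word d (b @ c) X w)"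
    by (simp add: sum.cartesian_product)
  also have "\<dots> = (\<Sum>(b, c)\<in>{(b, c). b @ c \<in> W}. f b * g c * phi_word d (b @ c) X w)"
  proof (rule sum.mono_neutral_right)
    have "f b * g c * phi_word d (b @ c) X w = 0" if "b @ c \<notin> W" for b c
      using that phi_word_eq_0[of w "b @ c" d X] by (simp add: W_def n_def)
    then show "\<forall>x\<in>W \<times> W - {(b, c). b @ c \<in> W}.
        (case x of (b, c) \<Rightarrow> f b * g c * phi_word d (b @ c) X w) = 0"
      by (auto simp del: mult_eq_0_iff)
  qed (auto simp: W_def fin n_def)
  also have "\<dots> = (\<Sum>(e, i)\<in>Sigma W (\<lambda>e. {..length e}).
      f (take i e) * g (drop i e) * phi_word d e X w)"
    by (rule sum.reindex_bij_witness[where i = "\<lambda>(e, i). (take i e, drop i e)"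
          and j = "\<lambda>(b, c). (b @ c, length b)"]) auto
  also have "\<dots> = (\<Sum>e\<in>W. \<Sum>i\<le>length e. f (take i e) * g (drop i e) * phi_word d e X w)"
    by (rule sum.Sigma[symmetric]) (auto simp: fin)
  also have "\<dots> = phi d (conc f g) X w"
    by (simp add: phi_def conc_def W_def n_def sum_distrib_right)
  finally show "phi d (conc f g) X w = phi d f (phi d g X) w" by simp
qed


section \<open>The coproduct on the symmetric algebra\<close>

text \<open>
  \<open>V\<close> has basis the linear forms indexed by words. \<open>H = S(V)\<close> is the polynomial algebra in these,
  i.e. the algebra of the monoid \<open>word \<Rightarrow>\<^sub>0 nat\<close> of monomials, and \<open>H \<otimes> H\<close> is the algebra of the
  product monoid: the pair \<open>(m, n)\<close> stands for \<open>m \<otimes> n\<close>, and likewise in \<open>V \<otimes> V\<close>.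
\<close>

type_synonym 'k V = "word \<Rightarrow>\<^sub>0 'k"

type_synonym 'k V2 = "(word \<times> word) \<Rightarrow>\<^sub>0 'k"

type_synonym 'k H = "(word \<Rightarrow>\<^sub>0 nat) \<Rightarrow>\<^sub>0 'k"

type_synonym 'k H2 = "((word \<Rightarrow>\<^sub>0 nat) \<times> (word \<Rightarrow>\<^sub>0 nat)) \<Rightarrow>\<^sub>0 'k"

definition coord :: "word \<Rightarrow> 'k::field_char_0 V" where
  "coord c = single c 1"

definition H_of_V :: "'k::field_char_0 V \<Rightarrow> 'k H" where
  "H_of_V x = (\<Sum>c\<in>keys x. single (single c 1) (lookup x c))"

definition eval_monom :: "(word \<Rightarrow>\<^sub>0 nat) \<Rightarrow> 'k::field_char_0 series \<Rightarrow> 'k" where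
  "eval_monom m f = (\<Prod>c\<in>keys m. f c ^ lookup m c)"

definition eval_H2 :: "'k::field_char_0 H2 \<Rightarrow> 'k series \<Rightarrow> 'k series \<Rightarrow> 'k" where
  "eval_H2 T f g = (\<Sum>(m, n)\<in>keys T. lookup T (m, n) * eval_monom m f * eval_monom n g)"

definition algebra_morphism :: "('k::field_char_0 H \<Rightarrow> 'k H2) \<Rightarrow> bool" where
  "algebra_morphism D \<longleftrightarrow>
     (\<forall>p q. D (p + q) = D p + D q) \<and>
     (\<forall>p q. D (p * q) = D p * D q) \<and>
     (\<forall>k. D (single 0 k) = single 0 k)"

definition Delta :: "'k::field_char_0 H \<Rightarrow> 'k H2" where
  "Delta = (THE D. algebra_morphism D \<and>
     (\<forall>c f g. eval_H2 (D (H_of_V (coord c))) f g = series_comp f g c))"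

text \<open>
  \<open>map_key\<close> is precomposition of the coefficient function, so \<open>proj_V\<close> keeps the coefficients of
  the degree one monomials, and \<open>proj_V2\<close>, its tensor square, those of the tensors of two such
  monomials.
\<close>

definition proj_V :: "'k::field_char_0 H \<Rightarrow> 'k V" where
  "proj_V = Poly_Mapping.map_key (\<lambda>c. single c 1)"

definition proj_V2 :: "'k::field_char_0 H2 \<Rightarrow> 'k V2" where
  "proj_V2 = Poly_Mapping.map_key (\<lambda>(a, b). (single a 1, single b 1))"

lemma single_1_inject: "single a (1::nat) = single b 1 \<Longrightarrow> a = b"
  by (metis lookup_single_eq lookup_single_not_eq zero_neq_one)

lemma lookup_proj_V: "lookup (proj_V p) c = lookup p (single c 1)"
proof -
  have "inj (\<lambda>c::word. single c (1::nat))"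
    by (intro injI) (rule single_1_inject)
  then show ?thesis
    by (simp add: proj_V_def map_key.rep_eq)
qed

lemma lookup_proj_V2:
  "lookup (proj_V2 T) (a, b) = lookup T (single a 1, single b 1)"
proof -
  have "inj (\<lambda>(a::word, b::word). (single a (1::nat), single b (1::nat)))"
    by (auto intro!: injI dest: single_1_inject simp del: One_nat_def)
  then show ?thesis
    by (simp add: proj_V2_def map_key.rep_eq)
qed

lemma proj_V2_tensor:
  "lookup (proj_V2 (single (m, n) 1)) (a, b) =
     lookup (proj_V (single m 1)) a * lookup (proj_V (single n 1)) b"
  by (simp add: lookup_proj_V lookup_proj_V2 lookup_single when_def)

definition delta :: "'k::field_char_0 V \<Rightarrow> 'k V2" where
  "delta x = proj_V2 (Delta (H_of_V x))"

text \<open>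
  The product dual to \<open>delta\<close>, extended bilinearly from words. The coefficients below have finite
  support because \<open>delta\<close> is homogeneous for a grading with finite-dimensional components.
\<close>

definition bullet :: "'k::field_char_0 ncpoly \<Rightarrow> 'k ncpoly \<Rightarrow> 'k ncpoly" (infixl "\<bullet>" 70) where
  "p \<bullet> q = Abs_poly_mapping (\<lambda>w.
     \<Sum>u\<in>keys p. \<Sum>v\<in>keys q. lookup p u * lookup q v * lookup (delta (coord w)) (u, v))"

end

theory Submission
  imports Defs
begin

text \<open>
  The monomial functions are multiplicative, so Artin's theorem on the linear independence of
  characters shows that an element of \<open>H \<otimes> H\<close> is determined by its values. Hence \<open>Delta\<close> is well
  defined, and \<open>Delta (X\<^sub>w)\<close> is any element of \<open>H \<otimes> H\<close> with values \<open>(f \<circ> g)\<^sub>w\<close>. Such an element is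
  obtained by running the recursion for \<open>\<phi>\<^sub>g(c)(\<emptyset>)\<close> with indeterminate coefficients of \<open>g\<close>. Its
  part linear in \<open>g\<close> satisfies the recursion of the proposition, because the part constant in \<open>g\<close>
  is \<open>\<phi>\<^sub>0(c)(\<emptyset>) = c\<close>.
\<close>

section \<open>Algebra morphisms from monoid algebras\<close>

text \<open>Reduces additive statements to one-term elements; bilinear identities follow from one
  such induction in each argument.\<close>

lemma poly_mapping_induct [case_names single sum]:
  fixes p :: "'a \<Rightarrow>\<^sub>0 'b::comm_monoid_add"
  assumes single: "\<And>m a. P (single m a)" and sum: "\<And>p q. P p \<Longrightarrow> P q \<Longrightarrow> P (p + q)"
  shows "P p"
proof (induction p rule: update_induct)
  case const
  show ?case using single[of _ 0] by simp
next
  case (update f a b)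
  have "Poly_Mapping.update a b f = single a b + f"
    using update(1)
    by (intro poly_mapping_eqI)
       (auto simp: lookup_update lookup_add lookup_single when_def in_keys_iff)
  then show ?case using single sum update by metis
qed

text \<open>The extension property of a commutative monoid algebra. The coefficient map is a
  parameter because two cases occur: the identity, for evaluation on \<open>H \<otimes> H\<close>,
  and the embedding of constants, for morphisms from \<open>H\<close> to
  \<open>H \<otimes> H\<close>.\<close>

locale monoid_algebra_lift =
  fixes \<phi> :: "'k::comm_semiring_1 \<Rightarrow> 'r::comm_semiring_1" and M :: "'m::comm_monoid_add \<Rightarrow> 'r"
  assumes \<phi>_zero: "\<phi> 0 = 0"
    and \<phi>_add: "\<phi> (a + b) = \<phi> a + \<phi> b"
    and \<phi>_mult: "\<phi> (a * b) = \<phi> a * \<phi> b"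
    and M_zero: "M 0 = 1"
    and M_add: "M (m + n) = M m * M n"
begin

definition lift :: "('m \<Rightarrow>\<^sub>0 'k) \<Rightarrow> 'r" where
  "lift p = (\<Sum>m\<in>keys p. \<phi> (lookup p m) * M m)"

lemma lift_eq_sum:
  assumes "finite S" "keys p \<subseteq> S"
  shows "lift p = (\<Sum>m\<in>S. \<phi> (lookup p m) * M m)"
  unfolding lift_def using assms
  by (intro sum.mono_neutral_left) (auto simp: \<phi>_zero in_keys_iff)

lemma lift_add: "lift (p + q) = lift p + lift q"
proof -
  let ?S = "keys p \<union> keys q"
  have "lift (p + q) = (\<Sum>m\<in>?S. \<phi> (lookup (p + q) m) * M m)"
    by (rule lift_eq_sum) (simp_all add: Poly_Mapping.keys_add)
  moreover have "lift p = (\<Sum>m\<in>?S. \<phi> (lookup p m) * M m)"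
    by (rule lift_eq_sum) auto
  moreover have "lift q = (\<Sum>m\<in>?S. \<phi> (lookup q m) * M m)"
    by (rule lift_eq_sum) auto
  ultimately show ?thesis
    by (simp add: lookup_add \<phi>_add distrib_right sum.distrib)
qed

lemma lift_single: "lift (single m a) = \<phi> a * M m"
  by (simp add: lift_def \<phi>_zero)

lemma lift_mult: "lift (p * q) = lift p * lift q"
proof (induction p rule: poly_mapping_induct)
  case (single m a)
  show ?case
  proof (induction q rule: poly_mapping_induct)
    case (single n b)
    show ?case
      by (simp add: mult_single lift_single \<phi>_mult M_add mult_ac)
  qed (simp add: distrib_left lift_add)
qed (simp add: distrib_right lift_add)

lemma lift_sum: "lift (\<Sum>i\<in>I. p i) = (\<Sum>i\<in>I. lift (p i))"
  by (induction I rule: infinite_finite_induct) (auto simp: lift_add, simp_all add: lift_def)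

end

text \<open>The product is the monomial \<open>m\<close> evaluated at \<open>t\<close>. The target
  is any commutative monoid, since \<open>t\<close> is a series in evaluations but a family in
  \<open>H \<otimes> H\<close> when \<open>Delta\<close> is built.\<close>

lemma prod_power_keys_superset:
  fixes t :: "'a \<Rightarrow> 'b::comm_monoid_mult"
  assumes "finite S" "keys m \<subseteq> S"
  shows "(\<Prod>c\<in>keys m. t c ^ lookup m c) = (\<Prod>c\<in>S. t c ^ lookup m c)"
  using assms by (intro prod.mono_neutral_left) (auto simp: in_keys_iff)

lemma prod_power_keys_add:
  fixes t :: "'a \<Rightarrow> 'b::comm_monoid_mult"
  shows "(\<Prod>c\<in>keys (m + n). t c ^ lookup (m + n) c) =
    (\<Prod>c\<in>keys m. t c ^ lookup m c) * (\<Prod>c\<in>keys n. t c ^ lookup n c)"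
proof -
  let ?S = "keys m \<union> keys n"
  have "(\<Prod>c\<in>keys (m + n). t c ^ lookup (m + n) c) = (\<Prod>c\<in>?S. t c ^ lookup (m + n) c)"
    by (rule prod_power_keys_superset) (simp_all add: Poly_Mapping.keys_add)
  moreover have "(\<Prod>c\<in>keys m. t c ^ lookup m c) = (\<Prod>c\<in>?S. t c ^ lookup m c)"
    by (rule prod_power_keys_superset) auto
  moreover have "(\<Prod>c\<in>keys n. t c ^ lookup n c) = (\<Prod>c\<in>?S. t c ^ lookup n c)"
    by (rule prod_power_keys_superset) auto
  ultimately show ?thesis
    by (simp add: lookup_add power_add prod.distrib)
qed

lemma prod_power_keys_single:
  fixes t :: "'a \<Rightarrow> 'b::comm_monoid_mult"
  shows "(\<Prod>c\<in>keys (single a n). t c ^ lookup (single a n) c) = t a ^ n"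
  by (subst prod_power_keys_superset[of "{a}"]) auto

text \<open>By cancellation, multiplying by \<open>single m k\<close> shifts monomials injectively,
  so a single term contributes.\<close>

lemma lookup_single_times_add:
  fixes p :: "'m::cancel_comm_monoid_add \<Rightarrow>\<^sub>0 'k::semiring_0"
  shows "lookup (single m k * p) (m + n) = k * lookup p n"
proof (induction p rule: poly_mapping_induct)
  case (single l a)
  then show ?case by (simp add: mult_single lookup_single when_def)
qed (simp add: distrib_left lookup_add)

lemma lookup_single_times_eq_0:
  fixes p :: "'m::monoid_add \<Rightarrow>\<^sub>0 'k::semiring_0"
  assumes "\<And>n. l \<noteq> m + n"
  shows "lookup (single m k * p) l = 0"
proof (induction p rule: poly_mapping_induct)
  case (single n a)
  then show ?case using assms[of n] by (auto simp: mult_single lookup_single when_def)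
qed (simp add: distrib_left lookup_add)


section \<open>Polynomial functions on pairs of series\<close>

text \<open>Artin's elimination: translating the relation by \<open>y\<close> and subtracting
  \<open>\<chi> j y\<close> times the original removes the term at \<open>j\<close>, so induction
  applies to the remaining ones.\<close>

lemma characters_independent:
  fixes \<chi> :: "'i \<Rightarrow> 'a \<Rightarrow> 'k::idom" and op :: "'a \<Rightarrow> 'a \<Rightarrow> 'a"
  assumes mult: "\<And>i x y. \<chi> i (op x y) = \<chi> i x * \<chi> i y"
    and one: "\<And>i. \<chi> i e = 1" and inj: "inj \<chi>" and "finite S"
    and zero: "\<And>x. (\<Sum>i\<in>S. k i * \<chi> i x) = 0" and "i \<in> S"
  shows "k i = 0"
  using \<open>finite S\<close> zero \<open>i \<in> S\<close>
proof (induction S arbitrary: k i rule: finite_induct)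
  case (insert j S)
  have k0: "k i = 0" if i: "i \<in> S" for i
  proof -
    have "(\<Sum>i\<in>S. k i * (\<chi> i y - \<chi> j y) * \<chi> i x) = 0" for x y
    proof -
      have "(\<Sum>i\<in>S. k i * (\<chi> i y - \<chi> j y) * \<chi> i x) =
          (\<Sum>i\<in>insert j S. k i * \<chi> i (op y x)) - \<chi> j y * (\<Sum>i\<in>insert j S. k i * \<chi> i x)"
        using insert.hyps by (simp add: mult sum_subtractf sum_distrib_left algebra_simps)
      then show ?thesis using insert.prems(1) by simp
    qed
    then have *: "k i * (\<chi> i y - \<chi> j y) = 0" for y
      using insert.IH[where k = "\<lambda>i. k i * (\<chi> i y - \<chi> j y)"] i by blast
    have "\<chi> i \<noteq> \<chi> j" using inj i insert.hyps by (auto dest: injD)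
    then obtain y where "\<chi> i y \<noteq> \<chi> j y" by blast
    with *[of y] show ?thesis by simp
  qed
  \<comment> \<open>At the unit \<open>e\<close> every character is 1, so the relation reduces to
    its last coefficient.\<close>
  have "k j = 0"
    using insert.prems(1)[of e] insert.hyps k0 by (simp add: one)
  with k0 insert.prems(2) show ?case by blast
qed simp

lemma eval_monom_mult: "eval_monom m (\<lambda>c. f c * g c) = eval_monom m f * eval_monom m g"
  by (simp add: eval_monom_def power_mult_distrib prod.distrib)

lemma eval_monom_one: "eval_monom m (\<lambda>_. 1) = 1"
  by (simp add: eval_monom_def)

lemma eval_monom_zero: "eval_monom 0 f = 1"
  by (simp add: eval_monom_def)

lemma eval_monom_add: "eval_monom (m + n) f = eval_monom m f * eval_monom n f"
  unfolding eval_monom_def by (rule prod_power_keys_add)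

lemma eval_monom_single: "eval_monom (single c n) f = f c ^ n"
  unfolding eval_monom_def by (rule prod_power_keys_single)

text \<open>The series with value 2 at \<open>c\<close> and 1 elsewhere reads off 2 to the exponent
  of \<open>c\<close>; in characteristic zero this determines the exponent.\<close>

lemma inj_eval_monom: "inj (eval_monom :: _ \<Rightarrow> 'k::field_char_0 series \<Rightarrow> _)"
proof
  fix m n
  assume eq: "(eval_monom m :: 'k series \<Rightarrow> _) = eval_monom n"
  have ev: "eval_monom l ((\<lambda>_. 1)(c := 2) :: 'k series) = 2 ^ lookup l c" for l c
  proof -
    have "eval_monom l ((\<lambda>_. 1)(c := 2) :: 'k series) =
        (\<Prod>b\<in>insert c (keys l). ((\<lambda>_. 1)(c := 2)) b ^ lookup l b)"
      unfolding eval_monom_def by (rule prod_power_keys_superset) auto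
    also have "\<dots> = (\<Prod>b\<in>{c}. ((\<lambda>_. 1)(c := 2)) b ^ lookup l b)"
      by (rule prod.mono_neutral_right) auto
    finally show ?thesis by simp
  qed
  show "m = n"
  proof (rule poly_mapping_eqI)
    fix c
    have "(2 :: 'k) ^ lookup m c = 2 ^ lookup n c"
      using eq ev by metis
    then have "(of_nat (2 ^ lookup m c) :: 'k) = of_nat (2 ^ lookup n c)"
      by simp
    then show "lookup m c = lookup n c"
      unfolding of_nat_eq_iff by simp
  qed
qed

text \<open>Indices and arguments are paired so that each tensor of monomials is one character on
  pairs of series.\<close>

definition eval_bimonom ::
  "(word \<Rightarrow>\<^sub>0 nat) \<times> (word \<Rightarrow>\<^sub>0 nat) \<Rightarrow> 'k::field_char_0 series \<times> 'k series \<Rightarrow> 'k" where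
  "eval_bimonom = (\<lambda>(m, n) (f, g). eval_monom m f * eval_monom n g)"

lemma eval_bimonom_Pair: "eval_bimonom (m, n) (f, g) = eval_monom m f * eval_monom n g"
  by (simp add: eval_bimonom_def)

lemma inj_eval_bimonom: "inj (eval_bimonom :: _ \<Rightarrow> 'k::field_char_0 series \<times> _ \<Rightarrow> _)"
proof (rule injI, clarify)
  fix m n m' n'
  assume "(eval_bimonom (m, n) :: 'k series \<times> _ \<Rightarrow> _) = eval_bimonom (m', n')"
  then have eq: "eval_monom m f * eval_monom n g = eval_monom m' f * eval_monom n' g"
    for f g :: "'k series"
    by (auto simp: eval_bimonom_def dest: fun_cong[where x = "(f, g)"])
  \<comment> \<open>The constant series 1 gives every monomial the value 1, which isolates one
    factor.\<close>
  have "eval_monom m f = eval_monom m' f" for f :: "'k series"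
    using eq[of f "\<lambda>_. 1"] by (simp add: eval_monom_one)
  moreover have "eval_monom n g = eval_monom n' g" for g :: "'k series"
    using eq[of "\<lambda>_. 1" g] by (simp add: eval_monom_one)
  ultimately show "m = m' \<and> n = n'"
    using inj_eval_monom by (blast dest: injD)
qed

interpretation eval_H2: monoid_algebra_lift
  "\<lambda>k. k" "\<lambda>m. eval_bimonom m (f, g)" for f g :: "'k::field_char_0 series"
  by standard
    (auto simp: eval_bimonom_Pair eval_monom_zero eval_monom_add mult_ac zero_prod_def)

lemma eval_H2_eq: "eval_H2 T f g = eval_H2.lift f g T"
  unfolding eval_H2_def eval_H2.lift_def
  by (rule sum.cong) (auto simp: eval_bimonom_Pair mult_ac)

lemma eval_H2_eqD:
  fixes T U :: "'k::field_char_0 H2"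
  assumes "\<And>f g. eval_H2 T f g = eval_H2 U f g"
  shows "T = U"
proof (rule poly_mapping_eqI)
  fix m
  let ?S = "keys T \<union> keys U"
  let ?k = "\<lambda>m. lookup T m - lookup U m"
  have "(\<Sum>m\<in>?S. ?k m * eval_bimonom m x) = 0" for x
  proof -
    obtain f g where x: "x = (f, g)" by (cases x)
    have "eval_H2 T f g = (\<Sum>m\<in>?S. lookup T m * eval_bimonom m x)"
      unfolding eval_H2_eq x by (rule eval_H2.lift_eq_sum) auto
    moreover have "eval_H2 U f g = (\<Sum>m\<in>?S. lookup U m * eval_bimonom m x)"
      unfolding eval_H2_eq x by (rule eval_H2.lift_eq_sum) auto
    ultimately show ?thesis
      using assms[of f g] by (simp add: left_diff_distrib sum_subtractf)
  qed
  note zero = this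
  \<comment> \<open>The characters are taken for the pointwise product of series, with unit the
    constant 1; concatenation and shuffle do not enter.\<close>
  have "?k m = 0" if "m \<in> ?S"
  proof (rule characters_independent[where \<chi> = eval_bimonom and S = ?S and k = ?k
        and op = "\<lambda>(f, g) (f', g'). (\<lambda>c. f c * f' c, \<lambda>c. g c * g' c)"
        and e = "(\<lambda>_. 1, \<lambda>_. 1)"])
    show "eval_bimonom i
      ((\<lambda>(f, g) (f', g'). (\<lambda>c. f c * f' c, \<lambda>c. g c * g' c)) x y) =
        eval_bimonom i x * eval_bimonom i y" for i and x y :: "'k series \<times> 'k series"
      by (cases i; cases x; cases y) (simp add: eval_bimonom_Pair eval_monom_mult)
  qed (use zero that inj_eval_bimonom in
      \<open>auto simp: eval_bimonom_def eval_monom_one split: prod.splits\<close>)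
  then show "lookup T m = lookup U m"
    by (cases "m \<in> ?S") (auto simp: in_keys_iff)
qed


section \<open>The coproduct on the generators\<close>

lemma H_of_V_coord: "H_of_V (coord c) = single (single c 1) 1"
  by (simp add: H_of_V_def coord_def)

text \<open>The coordinate forms generate \<open>H\<close>: monomials are products of them, and
  scalars are fixed by both morphisms.\<close>

lemma algebra_morphism_eqI:
  fixes D E :: "'k::field_char_0 H \<Rightarrow> 'k H2"
  assumes D: "algebra_morphism D" and E: "algebra_morphism E"
    and eq: "\<And>c. D (H_of_V (coord c)) = E (H_of_V (coord c))"
  shows "D = E"
proof
  have add: "D (p + q) = D p + D q" "E (p + q) = E p + E q"
    and mult: "D (p * q) = D p * D q" "E (p * q) = E p * E q"
    and scal: "D (single 0 k) = single 0 k" "E (single 0 k) = single 0 k" for p q k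
    using D E by (auto simp: algebra_morphism_def)
  have mono: "D (single (m + n) 1) = E (single (m + n) 1)"
    if "D (single m 1) = E (single m 1)" "D (single n 1) = E (single n 1)" for m n
    using that mult[of "single m 1" "single n 1"] by (simp add: mult_single)
  have monom: "D (single m 1) = E (single m 1)" for m
  proof (induction m rule: poly_mapping_induct)
    case (single c n)
    show ?case
    proof (induction n)
      case (Suc n)
      have "single c (Suc n) = single c 1 + single c n"
        by (simp flip: single_add)
      with mono[of "single c 1" "single c n"] Suc eq show ?case
        by (simp add: H_of_V_coord)
    qed (use scal[of 1] in simp)
  qed (rule mono)
  fix p
  show "D p = E p"
  proof (induction p rule: poly_mapping_induct)
    case (single m k)
    have "single m k = single 0 k * single m 1"
      by (simp add: mult_single)
    then show ?case by (simp add: mult scal monom)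
  qed (simp add: add)
qed

text \<open>Resolves the \<open>THE\<close> in \<open>Delta\<close>: the family \<open>T\<close>
  extends to a morphism, and any competitor agrees with it on generators because elements of
  \<open>H \<otimes> H\<close> are determined by their values.\<close>

lemma Delta_eqI:
  fixes T :: "word \<Rightarrow> 'k::field_char_0 H2"
  assumes T: "\<And>c f g. eval_H2 (T c) f g = series_comp f g c"
  shows "Delta (H_of_V (coord c)) = T c"
proof -
  interpret L: monoid_algebra_lift "single 0 :: 'k \<Rightarrow> 'k H2"
    "\<lambda>m. \<Prod>c\<in>keys m. T c ^ lookup m c"
    by standard (auto simp: single_add mult_single prod_power_keys_add)
  have morph: "algebra_morphism L.lift"
    by (simp add: algebra_morphism_def L.lift_add L.lift_mult L.lift_single)
  have gen: "L.lift (H_of_V (coord c)) = T c" for c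
    unfolding H_of_V_coord L.lift_single prod_power_keys_single by simp
  have Delta: "Delta = L.lift"
    unfolding Delta_def
  proof (rule the_equality)
    fix D :: "'k H \<Rightarrow> 'k H2"
    assume D: "algebra_morphism D \<and>
      (\<forall>c f g. eval_H2 (D (H_of_V (coord c))) f g = series_comp f g c)"
    show "D = L.lift"
      using D morph by (intro algebra_morphism_eqI eval_H2_eqD) (auto simp: gen T)
  qed (simp add: morph gen T)
  show ?thesis unfolding Delta by (rule gen)
qed

text \<open>The coefficient of \<open>w\<close> in \<open>\<phi>\<^sub>g(c)(\<emptyset>)\<close>, as a polynomial in the second argument \<open>g\<close>.\<close>

primrec phi_poly :: "word \<Rightarrow> word \<Rightarrow> 'k::field_char_0 H2" where
  "phi_poly [] w = (1 when w = [])"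
| "phi_poly (a # c) w = (case w of [] \<Rightarrow> 0 | b # w' \<Rightarrow>
     if a = b then phi_poly c w'
     else if a = X1 then \<Sum>(u, v) | length u + length v = length w'.
       single (0, single u 1) (lookup (shuffle_word u v) w') * phi_poly c v
     else 0)"

text \<open>Evaluation sends the indeterminate indexed by \<open>u\<close> to \<open>g u\<close>,
  turning the recursion of \<open>phi_poly\<close> into that of \<open>phi_word\<close>.\<close>

lemma eval_phi_poly: "eval_H2 (phi_poly c w) f g = phi_word g c (lookup (of_word [])) w"
proof (induction c arbitrary: w)
  case Nil
  show ?case
    using eval_H2.lift_single[of f g 0 1]
    by (auto simp: eval_H2_eq of_word_def lookup_single when_def eval_H2.M_zero eval_H2.lift_def)
next
  case (Cons a c)
  have zero: "eval_H2 0 f g = 0"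
    by (simp add: eval_H2_def)
  have lin: "eval_H2 (single (0, single u 1) k * T) f g = g u * eval_H2 T f g * k" for u k T
    by (simp add: eval_H2_eq eval_H2.lift_mult eval_H2.lift_single eval_bimonom_Pair
        eval_monom_zero eval_monom_single mult_ac del: One_nat_def)
  show ?case
  proof (cases w)
    case Nil
    then show ?thesis by (cases a) (auto simp: zero)
  next
    case [simp]: (Cons b w')
    have "eval_H2 (\<Sum>(u, v) | length u + length v = length w'.
          single (0, single u 1) (lookup (shuffle_word u v) w') * phi_poly c v) f g =
        shuffle g (phi_word g c (lookup (of_word []))) w'"
      unfolding shuffle_def
      by (subst eval_H2_eq, subst eval_H2.lift_sum)
         (auto simp: lin Cons.IH simp flip: eval_H2_eq simp del: One_nat_def
           intro!: sum.cong)
    then show ?thesis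
      by (cases a; cases b) (auto simp: Cons.IH zero)
  qed
qed

text \<open>The explicit value of \<open>Delta\<close> on the form of \<open>w\<close>. The sum is
  finite because longer words \<open>c\<close> do not reach \<open>w\<close>; the last term is the
  summand \<open>d\<close> of the composition.\<close>

definition comp_poly :: "word \<Rightarrow> 'k::field_char_0 H2" where
  "comp_poly w = (\<Sum>c | length c \<le> length w. single (single c 1, 0) 1 * phi_poly c w) +
     single (0, single w 1) 1"

lemma eval_comp_poly: "eval_H2 (comp_poly w) f g = series_comp f g w"
proof -
  have "eval_H2.lift f g (phi_poly c w) = phi_word g c (lookup (of_word [])) w" for c
    using eval_phi_poly by (simp add: eval_H2_eq)
  then show ?thesis
    by (simp add: comp_poly_def series_comp_def phi_def eval_H2_eq eval_H2.lift_add
        eval_H2.lift_sum eval_H2.lift_mult eval_H2.lift_single eval_bimonom_Pair eval_monom_zero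
        eval_monom_single del: One_nat_def)
qed

lemma delta_coord:
  "lookup (delta (coord w)) (u, v) = lookup (comp_poly w) (single u 1, single v 1)"
  by (simp add: delta_def lookup_proj_V2 Delta_eqI[OF eval_comp_poly] del: One_nat_def)


section \<open>The bilinear part of the coproduct\<close>

lemma single_1_neq_add:
  fixes m :: "'a \<Rightarrow>\<^sub>0 nat"
  assumes "u \<noteq> v"
  shows "single v 1 \<noteq> single u 1 + m"
proof
  assume "single v 1 = single u 1 + m"
  then have "lookup (single v (1::nat)) u = lookup (single u 1 + m) u" by simp
  with assms show False by (simp add: lookup_add lookup_single)
qed

lemma zero_neq_single_1_add:
  fixes m :: "'a \<Rightarrow>\<^sub>0 nat"
  shows "0 \<noteq> single u 1 + m"
proof
  assume "0 = single u 1 + m"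
  then have "lookup (0 :: 'a \<Rightarrow>\<^sub>0 nat) u = lookup (single u 1 + m) u" by simp
  then show False by (simp add: lookup_add)
qed

text \<open>A generator divides a generator only if they are equal, and the quotient is then
  1.\<close>

lemma lookup_fst_times:
  fixes T :: "'k::field_char_0 H2"
  shows "lookup (single (single c 1, 0) k * T) (single u 1, n) =
    (if c = u then k * lookup T (0, n) else 0)"
proof (cases "c = u")
  case True
  then show ?thesis
    using lookup_single_times_add[of "(single c 1, 0)" k T "(0, n)"] by simp
next
  case False
  then have "lookup (single (single c 1, 0) k * T) (single u 1, n) = 0"
    using single_1_neq_add[of c u] by (intro lookup_single_times_eq_0) (auto simp del: One_nat_def)
  with False show ?thesis by simp
qed

lemma lookup_snd_times:
  fixes T :: "'k::field_char_0 H2"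
  shows "lookup (single (0, single u 1) k * T) (m, single v 1) =
    (if u = v then k * lookup T (m, 0) else 0)"
proof (cases "u = v")
  case True
  then show ?thesis
    using lookup_single_times_add[of "(0, single u 1)" k T "(m, 0)"] by simp
next
  case False
  then have "lookup (single (0, single u 1) k * T) (m, single v 1) = 0"
    using single_1_neq_add[of u v] by (intro lookup_single_times_eq_0) (auto simp del: One_nat_def)
  with False show ?thesis by simp
qed

lemma lookup_snd_times_0:
  fixes T :: "'k::field_char_0 H2"
  shows "lookup (single (0, single u 1) k * T) (m, 0) = 0"
  using zero_neq_single_1_add[of u] by (intro lookup_single_times_eq_0) (auto simp del: One_nat_def)

text \<open>Each term of the shuffle branch contains an indeterminate of \<open>g\<close>, so only
  the branch prepending the letter itself survives.\<close>

lemma phi_poly_constant: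
  "lookup (phi_poly c w :: 'k::field_char_0 H2) (0, 0) = (1 when c = w)"
proof (induction c arbitrary: w)
  case Nil
  then show ?case by (auto simp: when_def lookup_one zero_prod_def)
next
  case (Cons a c)
  then show ?case
    by (auto simp: when_def lookup_sum lookup_snd_times_0 simp del: One_nat_def
        split: list.splits intro!: sum.neutral)
qed

text \<open>The three claimed identities read as a recursive definition, to be compared with the
  coefficients of \<open>delta\<close>.\<close>

primrec bullet_word :: "word \<Rightarrow> word \<Rightarrow> 'k::field_char_0 ncpoly" where
  "bullet_word [] v = 0"
| "bullet_word (a # u) v = of_letter a * bullet_word u v +
     (of_letter X0 * shuffle_word u v when a = X1)"

text \<open>Reconciles two conventions: the word indexing \<open>g\<close> is the left factor in
  \<open>phi_poly\<close>, the right one in \<open>bullet_word\<close>.\<close>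

lemma shuffle_word_commute: "shuffle_word u v = shuffle_word v u"
proof (induction u v rule: shuffle_word.induct)
  case (1 w)
  then show ?case by (cases w) auto
qed (auto simp: add.commute)

text \<open>In the shuffle branch the linear part takes its indeterminate from the explicit factor,
  hence the constant part of \<open>phi_poly\<close>; only the pair \<open>(v, c)\<close>
  remains.\<close>

lemma phi_poly_linear:
  "lookup (phi_poly c w :: 'k::field_char_0 H2) (0, single v 1) = lookup (bullet_word c v) w"
proof (induction c arbitrary: w)
  case Nil
  have "(0, single v (1::nat)) \<noteq> (0 :: (word \<Rightarrow>\<^sub>0 nat) \<times> _)"
    using zero_neq_single_1_add[of v 0] by (auto simp: zero_prod_def)
  then show ?case by (auto simp: when_def lookup_one simp del: One_nat_def)
next
  case (Cons a c)
  have "lookup (\<Sum>(u, v) | length u + length v = length w'.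
        single (0, single u 1) (lookup (shuffle_word u v) w') * phi_poly c v :: 'k H2)
        (0, single v 1) = lookup (shuffle_word c v) w'" for w'
  proof -
    let ?S = "{(a::word, b::word). length a + length b = length w'}"
    let ?F = "\<lambda>x. if x = (v, c) then lookup (shuffle_word c v :: 'k ncpoly) w' else 0"
    have "lookup (\<Sum>(u, v) | length u + length v = length w'.
        single (0, single u 1) (lookup (shuffle_word u v) w') * phi_poly c v :: 'k H2)
        (0, single v 1) = sum ?F ?S"
      unfolding lookup_sum
      by (rule sum.cong)
         (auto simp: lookup_snd_times phi_poly_constant when_def shuffle_word_commute[of v c]
           simp del: One_nat_def split: if_splits)
    \<comment> \<open>If \<open>(v, c)\<close> lies outside the index set, the lengths differ and
      the shuffle coefficient is 0 as well.\<close>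
    also have "\<dots> = lookup (shuffle_word c v) w'"
      using sum.delta[of ?S "(v, c)" "\<lambda>_. lookup (shuffle_word c v :: 'k ncpoly) w'"]
      by (auto simp: lookup_shuffle_word_eq_0)
    finally show ?thesis .
  qed
  then show ?case
    by (cases a; cases w; cases "hd w")
       (auto simp: Cons.IH lookup_times lookup_add simp del: One_nat_def)
qed

lemma lookup_bullet_word_eq_0: "length w < length u \<Longrightarrow> lookup (bullet_word u v) w = 0"
proof (induction u arbitrary: w)
  case (Cons a u)
  then show ?case
    by (cases w) (auto simp: lookup_times lookup_add when_def lookup_shuffle_word_eq_0)
qed simp

lemma delta_coord_eq_bullet_word:
  "lookup (delta (coord w) :: 'k::field_char_0 V2) (u, v) = lookup (bullet_word u v) w"
proof -
  \<comment> \<open>The summand of \<open>comp_poly\<close> coming from \<open>d\<close> has degree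
    0 on the left, so \<open>proj_V2\<close> discards it.\<close>
  have "(0, single w (1::nat)) \<noteq> (single u (1::nat), single v 1)"
    using zero_neq_single_1_add[of u 0] by auto
  then have "lookup (comp_poly w :: 'k H2) (single u 1, single v 1) =
      (\<Sum>c | length c \<le> length w. if c = u then lookup (bullet_word u v) w else 0)"
    by (auto simp: comp_poly_def lookup_add lookup_sum lookup_fst_times phi_poly_linear
        lookup_single when_def simp del: One_nat_def intro!: sum.cong)
  \<comment> \<open>For \<open>u\<close> longer than \<open>w\<close> the sum misses
    \<open>u\<close>, but the right side vanishes too.\<close>
  also have "\<dots> = lookup (bullet_word u v) w"
    by (auto simp: lookup_bullet_word_eq_0)
  finally show ?thesis by (simp add: delta_coord)
qed

text \<open>The function under \<open>Abs_poly_mapping\<close> is the coefficient function of a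
  polynomial, hence finitely supported, and the abstraction returns that polynomial.\<close>

lemma bullet_of_word: "of_word u \<bullet> of_word v = bullet_word u v"
  by (simp add: bullet_def of_word_def delta_coord_eq_bullet_word)

theorem proposition11:
  shows "(\<forall>c. of_word [] \<bullet> of_word c = (0 :: 'k::field_char_0 ncpoly)) \<and>
    (\<forall>c d. of_word (X0 # c) \<bullet> of_word d =
       (of_letter X0 * (of_word c \<bullet> of_word d) :: 'k ncpoly)) \<and>
    (\<forall>c d. of_word (X1 # c) \<bullet> of_word d =
       (of_letter X1 * (of_word c \<bullet> of_word d) + of_letter X0 * shuffle_word c d :: 'k ncpoly))"
  by (simp add: bullet_of_word)

end
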